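(* Let $n$ and $t$ be integers with $1 \leq t \leq n$, let $T = [t]$, and let $u$ be a non-negative real number such that $u > \frac{6-t}{3}$. Let $\mathcal{H}$ be a non-empty compressed hereditary subfamily of $2^{[n]}$. Let $h : \mathcal{H} \rightarrow \mathbb{R}^+$ be a function such that (a) $h(A) \geq (t+u)\,h(B)$ for every $A, B \in \mathcal{H}$ with $A \subsetneq B$ and $|A| \geq t$, and (b) $h(\delta_{i,j}(C)) \geq h(C)$ for every $C \in \mathcal{H}$ and every $i,j \in [n]$ with $i < j$. If $\mathcal{A}$ is a $t$-intersecting subfamily of $\mathcal{H}$, then \[h(\mathcal{A}) \leq h(\mathcal{H}(T)).\] Moreover, if $u > 0$ and $\mathcal{H}$ has a member of size at least $t$, then the bound is attained if and only if $\mathcal{A} = \mathcal{H}(T')$ for some $t$-element set $T'$ such that $h(\mathcal{H}(T')) = h(\mathcal{H}(T))$.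
   Context: $[n]=\{1,\dots,n\}$; $2^{[n]}$ is the family of all subsets of $[n]$; $\mathbb{R}^+$ is the set of positive real numbers. For a family $\mathcal{F}$ and a set $T$, $\mathcal{F}(T) = \{F \in \mathcal{F} : T \subseteq F\}$. For $i,j \in [n]$, $\delta_{i,j} : 2^{[n]} \to 2^{[n]}$ is defined by $\delta_{i,j}(A) = (A \setminus \{j\}) \cup \{i\}$ if $j \in A$ and $i \notin A$, and $\delta_{i,j}(A) = A$ otherwise. A family $\mathcal{F} \subseteq 2^{[n]}$ is compressed if $(F \setminus \{j\}) \cup \{i\} \in \mathcal{F}$ whenever $F \in \mathcal{F}$, $j \in F$, $i \in [n] \setminus F$ and $i < j$. A family is hereditary if it contains all subsets of each of its members. For $\mathcal{A} \subseteq \mathcal{H}$, $h(\mathcal{A}) = \sum_{A \in \mathcal{A}} h(A)$, which is $0$ if $\mathcal{A}$ is empty. A family $\mathcal{A}$ is $t$-intersecting if $|A \cap B| \geq t$ for all $A,B \in \mathcal{A}$, not necessarily distinct (so in particular every member has size at least $t$). *)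

theory Defs
  imports Complex_Main
begin

definition star :: "nat set set \<Rightarrow> nat set \<Rightarrow> nat set set" where
  "star \<F> T = {F \<in> \<F>. T \<subseteq> F}"

definition shift :: "nat \<Rightarrow> nat \<Rightarrow> nat set \<Rightarrow> nat set" where
  "shift i j A = (if j \<in> A \<and> i \<notin> A then (A - {j}) \<union> {i} else A)"

definition compressed :: "nat \<Rightarrow> nat set set \<Rightarrow> bool" where
  "compressed n \<F> \<longleftrightarrow>
     (\<forall>F\<in>\<F>. \<forall>j\<in>F. \<forall>i\<in>{1..n} - F. i < j \<longrightarrow> (F - {j}) \<union> {i} \<in> \<F>)"

definition hereditary :: "nat set set \<Rightarrow> bool" where
  "hereditary \<F> \<longleftrightarrow> (\<forall>F\<in>\<F>. \<forall>G. G \<subseteq> F \<longrightarrow> G \<in> \<F>)"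

(* A and B may coincide, so every member of the family has size at least t. *)
definition t_intersecting :: "nat \<Rightarrow> nat set set \<Rightarrow> bool" where
  "t_intersecting t \<A> \<longleftrightarrow> (\<forall>A\<in>\<A>. \<forall>B\<in>\<A>. t \<le> card (A \<inter> B))"

end

theory Submission
  imports Defs
begin

text \<open>Write $[k]$ for $\{1,\dots,k\}$. The proof is a weighted form of the generating-set method of
Ahlswede and Khachatrian. Fix a $t$-intersecting subfamily of \<open>\<H>\<close> of largest weight. Shifting it as
long as possible (\<open>exists_compressed\<close>) changes neither the $t$-intersection property nor the sizes of
the members and does not lower the weight, so a heaviest family \<open>\<C>\<close> may be taken compressed.

Let $p$ be least such that any two members of \<open>\<C>\<close> meet in at least $t$ elements of $[p]$. If some
trace on $[p]$ has only $t$ elements, compression forces all members to contain $[t]$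
(\<open>small_trace_imp_star\<close>); this covers $p = t$. Otherwise minimality yields critical pairs: members $A$,
$B$ that share $p$ and meet in exactly $t$ elements of $[p]$. Compression makes such a pair cover $[p]$,
so the sizes of their traces add up to $p + t$. Deleting $p$ from some of these members multiplies
their weight by at least $t+u$ by (a), at the price of discarding their critical partners. Since \<open>\<C>\<close>
is heaviest, the gain cannot exceed the loss (\<open>exchange\<close>). Two applications exclude critical pairs
with traces of different sizes (\<open>critical_balanced\<close>). When all traces have the same size,
$p = t + 2m$, and averaging over the members that miss a given element of $[p-1]$ yields
$(t+u)\,m \le t + 2m - 1$, which the bound on $u$ contradicts unless $m = 1$ (\<open>critical_level\<close>).

In the remaining case $p = t+2$, every member meets $[t+2]$ in at least $t+1$ elements. The family of
all sets in \<open>\<H>\<close> with this property is compared directly with the star of $[t]$: the part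
outside the star splits into $t$ classes, and each of them is at least $t+u$ times lighter than one
fixed part of the star (\<open>frankl1_excess\<close>). Here $u \ge 0$ gives the bound, and $u > 0$ gives strictness.

For the case of equality, a compressed heaviest family is the star of $[t]$, so it contains a $t$-set.
As shifting preserves sizes, the original family also contains a $t$-set $T'$. Then every member
contains $T'$, and positivity of the weights forces equality with the star of $T'$.\<close>

section \<open>Shifting a whole family\<close>

text \<open>The usual compression of a family: a member stays in place when its shift is already
occupied, so that no two members collide.\<close>
definition shift_within :: "nat \<Rightarrow> nat \<Rightarrow> nat set set \<Rightarrow> nat set \<Rightarrow> nat set" where
  "shift_within i j \<C> A = (if shift i j A \<in> \<C> then A else shift i j A)"

lemma inj_on_shift_within: "inj_on (shift_within i j \<C>) \<C>"
proof (rule inj_onI)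
  fix A B
  assume AB: "A \<in> \<C>" "B \<in> \<C>" and eq: "shift_within i j \<C> A = shift_within i j \<C> B"
  consider "shift i j A \<in> \<C> \<or> shift i j B \<in> \<C>"
    | "shift i j A \<notin> \<C>" "shift i j B \<notin> \<C>" by blast
  then show "A = B"
  proof cases
    case 1
    then show ?thesis using AB eq by (auto simp: shift_within_def split: if_splits)
  next
    case 2
    have mem: "j \<in> A" "i \<notin> A" "j \<in> B" "i \<notin> B"
      using 2 AB by (auto simp: shift_def split: if_splits)
    have "A - {j} \<union> {i} = B - {j} \<union> {i}"
      using 2 eq mem by (simp add: shift_within_def shift_def)
    then show ?thesis using mem by blast
  qed
qed

lemma card_shift: "finite A \<Longrightarrow> card (shift i j A) = card A"
  by (simp add: shift_def card_Suc_Diff1 del: card_Diff_insert)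

lemma card_shift_within: "finite A \<Longrightarrow> card (shift_within i j \<C> A) = card A"
  by (simp add: shift_within_def card_shift)

lemma sum_shift_le:
  fixes A :: "nat set"
  assumes "finite A" "i < j"
  shows "\<Sum>(shift i j A) \<le> \<Sum>A" and "shift i j A \<noteq> A \<Longrightarrow> \<Sum>(shift i j A) < \<Sum>A"
proof -
  have less: "\<Sum>(shift i j A) < \<Sum>A" if "j \<in> A" "i \<notin> A"
  proof -
    have "\<Sum>A = j + \<Sum>(A - {j})" using assms(1) that(1) by (rule sum.remove)
    moreover have "\<Sum>(shift i j A) = i + \<Sum>(A - {j})"
      using that assms(1) by (simp add: shift_def)
    ultimately show ?thesis using assms(2) by simp
  qed
  show "shift i j A \<noteq> A \<Longrightarrow> \<Sum>(shift i j A) < \<Sum>A"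
    using less by (auto simp: shift_def split: if_splits)
  then show "\<Sum>(shift i j A) \<le> \<Sum>A" by (cases "shift i j A = A") auto
qed

lemma card_le_Suc_Diff: "card A \<le> Suc (card (A - {x}))"
  using card_Diff_singleton[of x A] by (cases "x \<in> A") (arith, simp)

text \<open>The critical case is a moved member $A$ against a member $B$ that stayed although it
contains $j$ and not $i$: then the shift of $B$ is in \<open>\<C>\<close>, and $A$ meets it exactly where the shift
of $A$ meets $B$.\<close>
lemma t_intersecting_shift_within:
  assumes inter: "t_intersecting t \<C>" and fin: "\<And>A. A \<in> \<C> \<Longrightarrow> finite A"
  shows "t_intersecting t (shift_within i j \<C> ` \<C>)"
proof -
  have one: "t \<le> card ((A - {j} \<union> {i}) \<inter> B)"
    if A: "A \<in> \<C>" "j \<in> A" "i \<notin> A" and B: "B \<in> \<C>" "shift i j B \<in> \<C>" for A B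
  proof -
    have AB: "t \<le> card (A \<inter> B)" and AsB: "t \<le> card (A \<inter> shift i j B)"
      using inter A B by (auto simp: t_intersecting_def)
    have finA: "finite A" by (rule fin) fact
    consider "i \<in> B" | "i \<notin> B" "j \<notin> B" | "i \<notin> B" "j \<in> B" by blast
    then show ?thesis
    proof cases
      case 1
      have "card (A \<inter> B) \<le> Suc (card (A \<inter> B - {j}))"
        by (rule card_le_Suc_Diff)
      also have "\<dots> = card (insert i (A \<inter> B - {j}))"
        using finA A(3) by simp
      also have "insert i (A \<inter> B - {j}) = (A - {j} \<union> {i}) \<inter> B"
        using 1 A by auto
      finally show ?thesis using AB by simp
    next
      case 2
      then have "(A - {j} \<union> {i}) \<inter> B = A \<inter> B" by auto
      then show ?thesis using AB by simp
    next
      case 3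
      then have "(A - {j} \<union> {i}) \<inter> B = A \<inter> shift i j B" using A by (auto simp: shift_def)
      then show ?thesis using AsB by simp
    qed
  qed
  have moved: "j \<in> A \<and> i \<notin> A \<and> shift_within i j \<C> A = A - {j} \<union> {i}"
    if "A \<in> \<C>" "shift i j A \<notin> \<C>" for A
    using that by (auto simp: shift_within_def shift_def split: if_splits)
  show ?thesis unfolding t_intersecting_def
  proof (clarsimp)
    fix A B assume AB: "A \<in> \<C>" "B \<in> \<C>"
    consider "shift i j A \<in> \<C>" "shift i j B \<in> \<C>"
      | "shift i j A \<in> \<C>" "shift i j B \<notin> \<C>"
      | "shift i j A \<notin> \<C>" "shift i j B \<in> \<C>"
      | "shift i j A \<notin> \<C>" "shift i j B \<notin> \<C>" by blast
    then show "t \<le> card (shift_within i j \<C> A \<inter> shift_within i j \<C> B)"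
    proof cases
      case 1
      then show ?thesis using AB inter by (simp add: shift_within_def t_intersecting_def)
    next
      case 2
      then show ?thesis using one[of B A] moved[of B] AB
        by (simp add: shift_within_def Int_commute)
    next
      case 3
      then show ?thesis using one[of A B] moved[of A] AB by (simp add: shift_within_def)
    next
      case 4
      note mA = moved[OF AB(1) 4(1)] and mB = moved[OF AB(2) 4(2)]
      have "shift_within i j \<C> A \<inter> shift_within i j \<C> B = shift i j (A \<inter> B)"
        using mA mB by (auto simp: shift_def)
      then show ?thesis using AB inter fin by (simp add: card_shift t_intersecting_def)
    qed
  qed
qed

section \<open>Weighted compressed hereditary families\<close>

locale weighted_family =
  fixes n t :: nat and u :: real and \<H> :: "nat set set" and h :: "nat set \<Rightarrow> real"
  assumes t_pos: "1 \<le> t" and u_nonneg: "0 \<le> u" and u_bound: "u > (6 - real t) / 3"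
    and ground: "\<H> \<subseteq> Pow {1..n}"
    and compr: "compressed n \<H>" and hered: "hereditary \<H>"
    and h_pos: "\<And>A. A \<in> \<H> \<Longrightarrow> h A > 0"
    and h_decay: "\<And>A B. \<lbrakk>A \<in> \<H>; B \<in> \<H>; A \<subset> B; t \<le> card A\<rbrakk> \<Longrightarrow> (real t + u) * h B \<le> h A"
    and h_shift: "\<And>C i j. \<lbrakk>C \<in> \<H>; i \<in> {1..n}; j \<in> {1..n}; i < j\<rbrakk> \<Longrightarrow> h C \<le> h (shift i j C)"
begin

lemma finite_\<H>: "finite \<H>"
  using ground by (rule finite_subset) simp

lemma finite_member: "A \<in> \<H> \<Longrightarrow> finite A"
  using ground by (meson PowD finite_atLeastAtMost finite_subset subsetD)

lemma member_range: "A \<in> \<H> \<Longrightarrow> x \<in> A \<Longrightarrow> x \<in> {1..n}"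
  using ground by blast

lemma subset_in_\<H>: "F \<in> \<H> \<Longrightarrow> G \<subseteq> F \<Longrightarrow> G \<in> \<H>"
  using hered unfolding hereditary_def by blast

lemma shift_in_\<H>:
  assumes "A \<in> \<H>" "i \<in> {1..n}" "i < j"
  shows "shift i j A \<in> \<H>"
  using assms compr unfolding compressed_def shift_def by auto

lemma sum_h_mono: "\<B> \<subseteq> \<C> \<Longrightarrow> \<C> \<subseteq> \<H> \<Longrightarrow> sum h \<B> \<le> sum h \<C>"
  by (intro sum_mono2) (auto intro: finite_subset[OF _ finite_\<H>] less_imp_le[OF h_pos])

lemma sum_h_psubset:
  assumes "\<B> \<subset> \<C>" "\<C> \<subseteq> \<H>"
  shows "sum h \<B> < sum h \<C>"
proof -
  obtain x where x: "x \<in> \<C> - \<B>" using assms by blast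
  have fin: "finite \<C>" using assms(2) finite_\<H> by (rule finite_subset)
  show ?thesis
    using sum_strict_mono2[of \<C> \<B> x h] fin x assms h_pos less_imp_le[OF h_pos] by blast
qed

text \<open>The first inequality makes the averaging estimate of the critical level $p = t + 2m$ fail more
and more clearly as $m$ grows; the second refutes it at $m = 2$.\<close>
lemma ratio_gt: "real t + u > 2" "real t + 2 * u > 3"
  using u_bound u_nonneg t_pos by (auto simp: field_simps)

text \<open>A shift with $i < j$ that changes the family lowers the total of all elements of all members, so
shifting terminates. The equality of size profiles is what transports a $t$-element member back to
the original family in the case of equality.\<close>
lemma exists_compressed:
  assumes "\<C> \<subseteq> \<H>" "t_intersecting t \<C>"
  shows "\<exists>\<D>\<subseteq>\<H>. t_intersecting t \<D> \<and> compressed n \<D> \<and> sum h \<C> \<le> sum h \<D> \<and> card ` \<D> = card ` \<C>"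
  using assms
proof (induction "\<Sum>A\<in>\<C>. \<Sum>A" arbitrary: \<C> rule: less_induct)
  case less
  show ?case
  proof (cases "compressed n \<C>")
    case True
    then show ?thesis using less.prems by blast
  next
    case False
    then obtain F i j where F: "F \<in> \<C>" "j \<in> F" "i \<in> {1..n} - F" "i < j" "F - {j} \<union> {i} \<notin> \<C>"
      unfolding compressed_def by blast
    let ?f = "shift_within i j \<C>"
    have finC: "finite \<C>" using less.prems(1) finite_\<H> by (rule finite_subset)
    have fin: "finite A" if "A \<in> \<C>" for A using that less.prems(1) finite_member by blast
    have i: "i \<in> {1..n}" and j: "j \<in> {1..n}" using F less.prems(1) member_range by auto
    have "\<Sum>(?f A) \<le> \<Sum>A" if "A \<in> \<C>" for A
      using sum_shift_le(1)[OF fin[OF that] F(4)] by (simp add: shift_within_def)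
    moreover have "\<Sum>(?f F) < \<Sum>F"
    proof -
      have s: "shift i j F = F - {j} \<union> {i}" using F by (simp add: shift_def)
      then have "shift i j F \<noteq> F" using F by auto
      then show ?thesis
        using sum_shift_le(2)[OF fin[OF F(1)] F(4)] s F(5) by (simp add: shift_within_def)
    qed
    ultimately have "(\<Sum>A\<in>\<C>. \<Sum>(?f A)) < (\<Sum>A\<in>\<C>. \<Sum>A)"
      using finC F(1) by (intro sum_strict_mono_ex1) auto
    then have smaller: "(\<Sum>A\<in>?f ` \<C>. \<Sum>A) < (\<Sum>A\<in>\<C>. \<Sum>A)"
      by (simp add: sum.reindex[OF inj_on_shift_within])
    have sub: "?f ` \<C> \<subseteq> \<H>"
      using less.prems(1) shift_in_\<H>[OF _ i F(4)] by (auto simp: shift_within_def)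
    have "sum h \<C> \<le> (\<Sum>A\<in>\<C>. h (?f A))"
      using less.prems(1) h_shift[OF _ i j F(4)] by (intro sum_mono) (auto simp: shift_within_def)
    then have heavier: "sum h \<C> \<le> sum h (?f ` \<C>)"
      by (simp add: sum.reindex[OF inj_on_shift_within])
    have sizes: "card ` ?f ` \<C> = card ` \<C>"
      by (auto simp: image_image card_shift_within fin)
    obtain \<D> where "\<D> \<subseteq> \<H>" "t_intersecting t \<D>" "compressed n \<D>"
        "sum h (?f ` \<C>) \<le> sum h \<D>" "card ` \<D> = card ` ?f ` \<C>"
      using less.hyps[OF smaller sub t_intersecting_shift_within[OF less.prems(2) fin]] by blast
    then show ?thesis using heavier sizes by (metis order_trans)
  qed
qed

section \<open>Pairs that meet critically in an initial segment\<close>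

text \<open>These pairs obstruct the deletion of $p$: it would bring their common trace down to
$t - 1$ elements.\<close>
definition critical :: "nat set set \<Rightarrow> nat \<Rightarrow> nat set \<Rightarrow> nat set \<Rightarrow> bool" where
  "critical \<C> p A B \<longleftrightarrow>
     A \<in> \<C> \<and> B \<in> \<C> \<and> p \<in> A \<and> p \<in> B \<and> card (A \<inter> B \<inter> {1..p}) = t"

lemma critical_mem: "critical \<C> p A B \<Longrightarrow> A \<in> \<C>"
  by (simp add: critical_def)

lemma critical_sym: "critical \<C> p A B \<longleftrightarrow> critical \<C> p B A"
  by (auto simp: critical_def Int_commute)

definition traces_intersect :: "nat set set \<Rightarrow> nat \<Rightarrow> bool" where
  "traces_intersect \<C> p \<longleftrightarrow> (\<forall>A\<in>\<C>. \<forall>B\<in>\<C>. t \<le> card (A \<inter> B \<inter> {1..p}))"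

lemma traces_intersectD: "traces_intersect \<C> p \<Longrightarrow> A \<in> \<C> \<Longrightarrow> B \<in> \<C> \<Longrightarrow> t \<le> card (A \<inter> B \<inter> {1..p})"
  by (simp add: traces_intersect_def)

text \<open>An element $k \in [p]$ outside $A \cup B$ could replace $p$ in $A$, and the new member would
meet $B$ in only $t-1$ elements of $[p]$.\<close>
lemma critical_cover:
  assumes sub: "\<C> \<subseteq> \<H>" and cC: "compressed n \<C>" and tr: "traces_intersect \<C> p"
    and cr: "critical \<C> p A B"
  shows "{1..p} \<subseteq> A \<union> B"
proof
  fix k assume k: "k \<in> {1..p}"
  show "k \<in> A \<union> B"
  proof (rule ccontr)
    assume nk: "k \<notin> A \<union> B"
    have "p \<in> A" "p \<in> B" "A \<in> \<C>" "B \<in> \<C>" using cr by (auto simp: critical_def)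
    have "p \<in> {1..p}" using k by auto
    have "k \<noteq> p" using nk \<open>p \<in> A\<close> by auto
    moreover have "p \<le> n" using member_range \<open>p \<in> A\<close> \<open>A \<in> \<C>\<close> sub by auto
    ultimately have "A - {p} \<union> {k} \<in> \<C>"
      using cC \<open>A \<in> \<C>\<close> \<open>p \<in> A\<close> k nk unfolding compressed_def by auto
    then have "t \<le> card ((A - {p} \<union> {k}) \<inter> B \<inter> {1..p})"
      using tr \<open>B \<in> \<C>\<close> by (rule_tac traces_intersectD)
    moreover have "(A - {p} \<union> {k}) \<inter> B \<inter> {1..p} \<subset> A \<inter> B \<inter> {1..p}"
      using nk \<open>p \<in> A\<close> \<open>p \<in> B\<close> \<open>k \<noteq> p\<close> \<open>p \<in> {1..p}\<close> by blast
    then have "card ((A - {p} \<union> {k}) \<inter> B \<inter> {1..p}) < card (A \<inter> B \<inter> {1..p})"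
      by (intro psubset_card_mono) auto
    ultimately show False using cr by (simp add: critical_def)
  qed
qed

lemma critical_card:
  assumes "\<C> \<subseteq> \<H>" "compressed n \<C>" "traces_intersect \<C> p" "critical \<C> p A B"
  shows "card (A \<inter> {1..p}) + card (B \<inter> {1..p}) = p + t"
proof -
  have "card (A \<inter> {1..p}) + card (B \<inter> {1..p})
      = card (A \<inter> {1..p} \<union> B \<inter> {1..p}) + card (A \<inter> {1..p} \<inter> (B \<inter> {1..p}))"
    by (rule card_Un_Int) auto
  also have "A \<inter> {1..p} \<union> B \<inter> {1..p} = {1..p}" using critical_cover[OF assms] by auto
  also have "A \<inter> {1..p} \<inter> (B \<inter> {1..p}) = A \<inter> B \<inter> {1..p}" by auto
  finally show ?thesis using assms(4) by (simp add: critical_def)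
qed

text \<open>A trace of size $t$ is contained in every member. If it were not $[t]$, shifting one of its
elements down would give a member that misses that element.\<close>
lemma small_trace_imp_star:
  assumes sub: "\<C> \<subseteq> \<H>" and cC: "compressed n \<C>" and tr: "traces_intersect \<C> p"
    and A: "A \<in> \<C>" "card (A \<inter> {1..p}) \<le> t"
  shows "\<C> \<subseteq> star \<H> {1..t}"
proof -
  let ?S = "A \<inter> {1..p}"
  have S_sub: "?S \<subseteq> B" if "B \<in> \<C>" for B
  proof -
    have "card ?S \<le> card (A \<inter> B \<inter> {1..p})"
      using traces_intersectD[OF tr A(1) that] A(2) by simp
    then have "A \<inter> B \<inter> {1..p} = ?S" by (intro card_seteq) auto
    then show ?thesis by blast
  qed
  have cardS: "card ?S = t" using traces_intersectD[OF tr A(1) A(1)] A(2) by simp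
  have "{1..t} \<subseteq> ?S"
  proof (rule ccontr)
    assume "\<not> {1..t} \<subseteq> ?S"
    then obtain i where i: "i \<in> {1..t}" "i \<notin> ?S" by blast
    have "\<not> ?S \<subseteq> {1..t}"
      using card_subset_eq[of "{1..t}" ?S] cardS i
      by (metis card_atLeastAtMost diff_Suc_1 finite_atLeastAtMost)
    then obtain j where j: "j \<in> ?S" "j > t" by force
    have "j \<le> n" using j A(1) sub member_range by auto
    then have "A - {j} \<union> {i} \<in> \<C>"
      using cC A(1) i j unfolding compressed_def by auto
    from S_sub[OF this] show False using i j by auto
  qed
  then show ?thesis using S_sub sub unfolding star_def by blast
qed

section \<open>Exchange argument in a heaviest family\<close>

definition heaviest :: "nat set set \<Rightarrow> bool" where
  "heaviest \<C> \<longleftrightarrow> \<C> \<subseteq> \<H> \<and> t_intersecting t \<C> \<and>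
     (\<forall>\<B>\<subseteq>\<H>. t_intersecting t \<B> \<longrightarrow> sum h \<B> \<le> sum h \<C>)"

text \<open>Deleting $p$ from the members of \<open>\<D>\<close> and discarding \<open>\<E>\<close>, which contains all critical partners
of \<open>\<D>\<close>, leaves a $t$-intersecting family. The shortened sets are new: one of them would meet a
critical partner of its original in only $t-1$ elements of $[p]$. So the weight rises by at least
$(t+u)\,h(\mathcal{D}) - h(\mathcal{E})$, which cannot be positive. The size condition on \<open>\<D>\<close> makes
the decay hypothesis applicable to the shortened sets.\<close>
lemma exchange:
  assumes hv: "heaviest \<C>" and tr: "traces_intersect \<C> p"
    and D: "\<And>A. A \<in> \<D> \<Longrightarrow> A \<in> \<C> \<and> p \<in> A \<and> t < card A \<and> (\<exists>B. critical \<C> p A B)"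
    and indep: "\<And>A B. A \<in> \<D> \<Longrightarrow> B \<in> \<D> \<Longrightarrow> \<not> critical \<C> p A B"
    and E: "\<E> \<subseteq> \<C>" "\<And>A B. A \<in> \<D> \<Longrightarrow> critical \<C> p A B \<Longrightarrow> B \<in> \<E>"
  shows "(real t + u) * sum h \<D> \<le> sum h \<E>"
proof -
  let ?D = "(\<lambda>A. A - {p}) ` \<D>"
  let ?new = "(\<C> - \<E>) \<union> ?D"
  have sub: "\<C> \<subseteq> \<H>" using hv by (simp add: heaviest_def)
  have finC: "finite \<C>" using sub finite_\<H> by (rule finite_subset)
  have newsub: "?new \<subseteq> \<H>" using sub D subset_in_\<H> by blast
  have fin: "finite A" if "A \<in> \<C>" for A using that sub finite_member by blast
  have loss: "t \<le> card ((A - {p}) \<inter> B)"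
    if "A \<in> \<D>" "B \<in> \<C>" "\<not> critical \<C> p A B" for A B
  proof (cases "p \<in> B")
    case False
    then have "(A - {p}) \<inter> B = A \<inter> B" by auto
    then show ?thesis using hv D that by (simp add: heaviest_def t_intersecting_def)
  next
    case True
    have "t < card (A \<inter> B \<inter> {1..p})"
      using traces_intersectD[OF tr] D[OF that(1)] that True
      by (metis critical_def le_neq_implies_less)
    also have "\<dots> \<le> Suc (card (A \<inter> B \<inter> {1..p} - {p}))" by (rule card_le_Suc_Diff)
    also have "card (A \<inter> B \<inter> {1..p} - {p}) \<le> card ((A - {p}) \<inter> B)"
      using fin D[OF that(1)] by (intro card_mono) auto
    finally show ?thesis by simp
  qed
  have "t_intersecting t ?new"
    unfolding t_intersecting_def
  proof (intro ballI)
    fix X Y assume XY: "X \<in> ?new" "Y \<in> ?new"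
    have oldnew: "t \<le> card ((A - {p}) \<inter> B)" if "A \<in> \<D>" "B \<in> \<C> - \<E>" for A B
      using loss that E(2) by blast
    have newnew: "t \<le> card ((A - {p}) \<inter> (B - {p}))" if "A \<in> \<D>" "B \<in> \<D>" for A B
    proof -
      have "(A - {p}) \<inter> (B - {p}) = (A - {p}) \<inter> B" by auto
      then show ?thesis using loss indep that D by simp
    qed
    consider "X \<in> \<C> - \<E>" "Y \<in> \<C> - \<E>" | "X \<in> ?D" "Y \<in> \<C> - \<E>"
      | "X \<in> \<C> - \<E>" "Y \<in> ?D" | "X \<in> ?D" "Y \<in> ?D"
      using XY by blast
    then show "t \<le> card (X \<inter> Y)"
    proof cases
      case 1
      then show ?thesis using hv by (simp add: heaviest_def t_intersecting_def)
    next
      case 2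
      then show ?thesis using oldnew by blast
    next
      case 3
      then show ?thesis using oldnew Int_commute[of X Y] by auto
    next
      case 4
      then show ?thesis using newnew by blast
    qed
  qed
  then have max: "sum h ?new \<le> sum h \<C>" using hv newsub by (simp add: heaviest_def)
  have fresh: "?D \<inter> \<C> = {}"
  proof (rule ccontr)
    assume "?D \<inter> \<C> \<noteq> {}"
    then obtain A where A: "A \<in> \<D>" "A - {p} \<in> \<C>" by blast
    then obtain B where B: "critical \<C> p A B" using D by blast
    have p: "p \<in> A \<inter> B \<inter> {1..p}"
    proof -
      have "p \<in> A" "p \<in> B" "A \<in> \<C>" using B by (auto simp: critical_def)
      moreover have "1 \<le> p" using member_range \<open>p \<in> A\<close> \<open>A \<in> \<C>\<close> sub by auto
      ultimately show ?thesis by simp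
    qed
    have "t \<le> card ((A - {p}) \<inter> B \<inter> {1..p})"
      using B by (intro traces_intersectD[OF tr A(2)]) (simp add: critical_def)
    also have "(A - {p}) \<inter> B \<inter> {1..p} = A \<inter> B \<inter> {1..p} - {p}" by auto
    also have "card \<dots> < card (A \<inter> B \<inter> {1..p})" using p by (intro card_Diff1_less) auto
    finally show False using B by (simp add: critical_def)
  qed
  have DC: "\<D> \<subseteq> \<C>" using D by blast
  have "inj_on (\<lambda>A. A - {p}) \<D>"
  proof (rule inj_onI)
    fix A B assume "A \<in> \<D>" "B \<in> \<D>" and eq: "A - {p} = B - {p}"
    then have "p \<in> A" "p \<in> B" using D by blast+
    then show "A = B" using eq by blast
  qed
  then have "sum h ?D = (\<Sum>A\<in>\<D>. h (A - {p}))" by (simp add: sum.reindex)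
  also have "\<dots> \<ge> (\<Sum>A\<in>\<D>. (real t + u) * h A)"
  proof (rule sum_mono)
    fix A assume A: "A \<in> \<D>"
    note dA = D[OF A]
    have AH: "A \<in> \<H>" using dA sub by blast
    have "A - {p} \<in> \<H>" by (rule subset_in_\<H>[OF AH]) blast
    moreover have "t \<le> card (A - {p})" using dA card_le_Suc_Diff[of A p] by linarith
    moreover have "A - {p} \<subset> A" using dA by blast
    ultimately show "(real t + u) * h A \<le> h (A - {p})" using AH by (intro h_decay)
  qed
  finally have gain: "(real t + u) * sum h \<D> \<le> sum h ?D" by (simp add: sum_distrib_left)
  have "sum h ?new = sum h (\<C> - \<E>) + sum h ?D"
  proof (rule sum.union_disjoint)
    show "finite ?D" using finite_subset[OF DC finC] by (rule finite_imageI)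
  qed (use finC fresh in blast)+
  also have "sum h (\<C> - \<E>) = sum h \<C> - sum h \<E>"
    using E(1) finC by (rule_tac sum_diff)
  finally show ?thesis using max gain by linarith
qed

text \<open>For trace sizes $i \ne j$ with $i + j = p + t$, members of one level are never critical to each
other and all their partners lie in the other level. Exchanging in both directions makes each of the
two levels heavier than the other.\<close>
lemma critical_balanced:
  assumes hv: "heaviest \<C>" and cC: "compressed n \<C>" and tr: "traces_intersect \<C> p"
    and big: "\<And>A. A \<in> \<C> \<Longrightarrow> t < card A"
    and cr: "critical \<C> p A B"
  shows "card (A \<inter> {1..p}) = card (B \<inter> {1..p})"
proof (rule ccontr)
  assume ne: "card (A \<inter> {1..p}) \<noteq> card (B \<inter> {1..p})"
  have sub: "\<C> \<subseteq> \<H>" using hv by (simp add: heaviest_def)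
  define L where "L i = {X \<in> \<C>. card (X \<inter> {1..p}) = i \<and> (\<exists>Y. critical \<C> p X Y)}" for i
  have Lsub: "L i \<subseteq> \<H>" for i using sub by (auto simp: L_def)
  have pos: "sum h (L i) > 0" if "X \<in> L i" for X i
    using that Lsub by (intro sum_pos) (auto intro: finite_subset[OF _ finite_\<H>] h_pos)
  have step: "(real t + u) * sum h (L i) \<le> sum h (L j)" if "i \<noteq> j" "i + j = p + t" for i j
  proof (rule exchange[OF hv tr])
    fix X assume "X \<in> L i"
    then show "X \<in> \<C> \<and> p \<in> X \<and> t < card X \<and> (\<exists>B. critical \<C> p X B)"
      using big by (auto simp: L_def critical_def)
  next
    fix X Y assume "X \<in> L i" "Y \<in> L i"
    then show "\<not> critical \<C> p X Y"
      using critical_card[OF sub cC tr, of X Y] that by (auto simp: L_def)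
  next
    show "L j \<subseteq> \<C>" by (auto simp: L_def)
  next
    fix X Y assume XY: "X \<in> L i" "critical \<C> p X Y"
    then have "card (Y \<inter> {1..p}) = j"
      using critical_card[OF sub cC tr, of X Y] that by (auto simp: L_def)
    moreover have "critical \<C> p Y X" using XY critical_sym by blast
    ultimately show "Y \<in> L j" unfolding L_def using critical_mem by blast
  qed
  let ?i = "card (A \<inter> {1..p})" and ?j = "card (B \<inter> {1..p})"
  have ij: "?i + ?j = p + t" by (rule critical_card[OF sub cC tr cr])
  have "A \<in> L ?i" "B \<in> L ?j"
    unfolding L_def using cr critical_sym critical_mem by blast+
  then have p: "sum h (L ?i) > 0" "sum h (L ?j) > 0" using pos by blast+
  have grow: "x < (real t + u) * x" if "0 < x" for x :: real
    using mult_strict_right_mono[of 1 "real t + u" x] that ratio_gt(1) by simp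
  show False
    using step[of ?i ?j] step[of ?j ?i] ne ij grow[OF p(1)] grow[OF p(2)] by simp
qed

text \<open>Two members that both miss some $k < p$ cannot be critical, since a critical pair covers $[p]$.
So, with \<open>L\<close> the set of all members of critical pairs, for each $k \in [p-1]$ those that miss $k$ can be exchanged against all of \<open>L\<close>. Each
member of \<open>L\<close> misses the same number $m$ of these $k$, and summing over $k$ bounds $t+u$.\<close>
lemma critical_level:
  assumes hv: "heaviest \<C>" and cC: "compressed n \<C>" and tr: "traces_intersect \<C> p"
    and big: "\<And>A. A \<in> \<C> \<Longrightarrow> t < card A" and "t < p"
    and cr: "critical \<C> p A B"
  shows "p = t + 2"
proof -
  have sub: "\<C> \<subseteq> \<H>" using hv by (simp add: heaviest_def)
  have finC: "finite \<C>" using sub finite_\<H> by (rule finite_subset)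
  define L where "L = {X \<in> \<C>. \<exists>Y. critical \<C> p X Y}"
  have finL: "finite L" using finC by (simp add: L_def)
  have size: "2 * card (X \<inter> {1..p}) = p + t" if "X \<in> L" for X
    using that critical_card[OF sub cC tr] critical_balanced[OF hv cC tr big]
    by (fastforce simp: L_def)
  have AL: "A \<in> L" using cr by (auto simp: L_def critical_def)
  \<comment> \<open>the common number of elements of $[p]$ missed by the members of \<open>L\<close>\<close>
  define m where "m = p - card (A \<inter> {1..p})"
  have le: "card (X \<inter> {1..p}) \<le> p" for X
    using card_mono[of "{1..p}" "X \<inter> {1..p}"] by simp
  have pm: "p = t + 2 * m" using size[OF AL] le[of A] by (simp add: m_def)
  have missing: "card {k \<in> {1..p-1}. k \<notin> X} = m" if X: "X \<in> L" for X
  proof -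
    have pX: "p \<in> X" using X by (auto simp: L_def critical_def)
    then have "{k \<in> {1..p-1}. k \<notin> X} = {1..p} - X \<inter> {1..p}"
      by (auto simp: le_less)
    then have "card {k \<in> {1..p-1}. k \<notin> X} = p - card (X \<inter> {1..p})"
      by (simp add: card_Diff_subset)
    then show ?thesis using size[OF X] size[OF AL] by (simp add: m_def)
  qed
  have step: "(real t + u) * sum h {X \<in> L. k \<notin> X} \<le> sum h L" if "k \<in> {1..p-1}" for k
  proof (rule exchange[OF hv tr])
    fix X assume "X \<in> {X \<in> L. k \<notin> X}"
    then show "X \<in> \<C> \<and> p \<in> X \<and> t < card X \<and> (\<exists>B. critical \<C> p X B)"
      using big by (auto simp: L_def critical_def)
  next
    fix X Y assume "X \<in> {X \<in> L. k \<notin> X}" "Y \<in> {X \<in> L. k \<notin> X}"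
    moreover have "k \<in> {1..p}" using that by auto
    ultimately show "\<not> critical \<C> p X Y"
      using critical_cover[OF sub cC tr, of X Y] by blast
  next
    show "L \<subseteq> \<C>" by (auto simp: L_def)
  next
    fix X Y assume "X \<in> {X \<in> L. k \<notin> X}" "critical \<C> p X Y"
    then show "Y \<in> L" unfolding L_def using critical_sym critical_mem by blast
  qed
  have "(\<Sum>k\<in>{1..p-1}. sum h {X \<in> L. k \<notin> X}) = (\<Sum>k\<in>{1..p-1}. \<Sum>X\<in>L. if k \<notin> X then h X else 0)"
    by (intro sum.cong refl sum.inter_filter finL)
  also have "\<dots> = (\<Sum>X\<in>L. \<Sum>k\<in>{1..p-1}. if k \<notin> X then h X else 0)"
    by (rule sum.swap)
  also have "\<dots> = (\<Sum>X\<in>L. real m * h X)"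
  proof (rule sum.cong[OF refl])
    fix X assume "X \<in> L"
    have "(\<Sum>k\<in>{1..p-1}. if k \<notin> X then h X else 0) = (\<Sum>k\<in>{k \<in> {1..p-1}. k \<notin> X}. h X)"
      by (rule sum.inter_filter[symmetric]) simp
    then show "(\<Sum>k\<in>{1..p-1}. if k \<notin> X then h X else 0) = real m * h X"
      unfolding sum_constant missing[OF \<open>X \<in> L\<close>] by simp
  qed
  also have "\<dots> = real m * sum h L" by (simp add: sum_distrib_left)
  finally have double: "(\<Sum>k\<in>{1..p-1}. sum h {X \<in> L. k \<notin> X}) = real m * sum h L" .
  have "(real t + u) * (real m * sum h L) = (\<Sum>k\<in>{1..p-1}. (real t + u) * sum h {X \<in> L. k \<notin> X})"
    unfolding double[symmetric] by (rule sum_distrib_left)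
  also have "\<dots> \<le> (\<Sum>k\<in>{1..p-1}. sum h L)" by (rule sum_mono) (rule step)
  also have "\<dots> = real (p - 1) * sum h L" by simp
  finally have "((real t + u) * real m) * sum h L \<le> real (p - 1) * sum h L"
    by (simp add: mult.assoc)
  moreover have "sum h L > 0"
    using AL finL sub by (intro sum_pos) (auto simp: L_def intro: h_pos)
  ultimately have "(real t + u) * real m \<le> real (p - 1)" by (simp add: mult_le_cancel_right)
  then have avg: "(real t + u - 2) * real m \<le> real t - 1"
    using pm t_pos by (simp add: algebra_simps)
  have "m < 2"
  proof (rule ccontr)
    assume "\<not> m < 2"
    then have "(real t + u - 2) * 2 \<le> (real t + u - 2) * real m"
      using ratio_gt(1) by (intro mult_left_mono) auto
    then show False using avg ratio_gt(2) by simp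
  qed
  then have "m = 1" using pm \<open>t < p\<close> by linarith
  then show ?thesis using pm by simp
qed

section \<open>Comparison with the first Frankl family\<close>

text \<open>The competitor of the star of $[t]$. In the full power set with weights
$h(A) = (t+u)^{-|A|}$ and $t + 2 \le n$, the two families have equal weight at $u = 0$.\<close>
definition frankl1 :: "nat set set" where
  "frankl1 = {A \<in> \<H>. t + 1 \<le> card (A \<inter> {1..t+2})}"

lemma frankl1_minus_star:
  "frankl1 - star \<H> {1..t} = (\<Union>x\<in>{1..t}. {A \<in> \<H>. A \<inter> {1..t+2} = {1..t+2} - {x}})"
proof (intro equalityI subsetI)
  fix A assume A: "A \<in> frankl1 - star \<H> {1..t}"
  then have "\<not> {1..t} \<subseteq> A" by (simp add: frankl1_def star_def)
  then obtain x where x: "x \<in> {1..t}" "x \<notin> A" by blast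
  have "A \<inter> {1..t+2} = {1..t+2} - {x}"
  proof (rule card_seteq)
    show "A \<inter> {1..t+2} \<subseteq> {1..t+2} - {x}" using x by blast
    have "x \<in> {1..t+2}" using x by simp
    then show "card ({1..t+2} - {x}) \<le> card (A \<inter> {1..t+2})"
      using A by (simp add: frankl1_def card_Diff_singleton)
  qed simp
  then show "A \<in> (\<Union>x\<in>{1..t}. {A \<in> \<H>. A \<inter> {1..t+2} = {1..t+2} - {x}})"
    using A x unfolding frankl1_def by blast
next
  fix A assume "A \<in> (\<Union>x\<in>{1..t}. {A \<in> \<H>. A \<inter> {1..t+2} = {1..t+2} - {x}})"
  then obtain x where x: "x \<in> {1..t}" "A \<in> \<H>" "A \<inter> {1..t+2} = {1..t+2} - {x}" by blast
  have "x \<in> {1..t+2}" using x(1) by simp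
  then have "card (A \<inter> {1..t+2}) = t + 1" "\<not> {1..t} \<subseteq> A"
    using x(1,3) by (simp add: card_Diff_singleton, blast)
  then show "A \<in> frankl1 - star \<H> {1..t}" using x(2) by (simp add: frankl1_def star_def)
qed

text \<open>A set whose trace on $[t+2]$ misses only $x \le t$ is sent into the star by replacing $t+2$ by
$x$, which does not lower the weight, and then deleting $t+1$, which multiplies it by at least
$t+u$. For fixed $x$ this is injective into the sets with trace $[t]$, and there are $t$ choices
of $x$.\<close>
lemma frankl1_excess:
  "(real t + u) * sum h (frankl1 - star \<H> {1..t}) \<le> real t * sum h (star \<H> {1..t} - frankl1)"
proof -
  define G where "G x = {A \<in> \<H>. A \<inter> {1..t+2} = {1..t+2} - {x}}" for x
  have finG: "finite (G x)" for x using finite_\<H> by (simp add: G_def)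
  have G: "(real t + u) * sum h (G x) \<le> sum h (star \<H> {1..t} - frankl1)" if x: "x \<in> {1..t}" for x
  proof -
    define \<phi> where "\<phi> A = insert x (A - {t+1, t+2})" for A
    have img: "\<phi> A \<in> \<H> \<and> \<phi> A \<inter> {1..t+2} = {1..t} \<and> (real t + u) * h A \<le> h (\<phi> A)"
      if A: "A \<in> G x" for A
    proof -
      have AH: "A \<in> \<H>" and Ax: "A \<inter> {1..t+2} = {1..t+2} - {x}" using A by (auto simp: G_def)
      have "y \<in> A \<longleftrightarrow> y \<noteq> x" if "y \<in> {1..t+2}" for y using Ax that by blast
      from this[of "t+1"] this[of "t+2"] this[of x]
      have mem: "t + 1 \<in> A" "t + 2 \<in> A" "x \<notin> A" using x by auto
      have "t + 2 \<le> n" using member_range[OF AH mem(2)] by simp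
      then have rng: "x \<in> {1..n}" "t + 2 \<in> {1..n}" "x < t + 2" using x by auto
      let ?S = "shift x (t+2) A"
      have S: "?S = A - {t+2} \<union> {x}" using mem by (simp add: shift_def)
      have SH: "?S \<in> \<H>" using AH rng by (intro shift_in_\<H>)
      have "t + 1 \<in> ?S" "t + 1 \<notin> \<phi> A" using S mem x by (auto simp: \<phi>_def)
      moreover have "\<phi> A \<subseteq> ?S" using S by (auto simp: \<phi>_def)
      ultimately have ps: "\<phi> A \<subset> ?S" by blast
      have tr: "\<phi> A \<inter> {1..t+2} = {1..t}"
      proof -
        have "\<phi> A \<inter> {1..t+2} = insert x (A \<inter> {1..t+2} - {t+1, t+2})"
          using x by (auto simp: \<phi>_def)
        also have "\<dots> = {1..t}" unfolding Ax using x by auto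
        finally show ?thesis .
      qed
      have H: "\<phi> A \<in> \<H>" using SH ps subset_in_\<H> by blast
      have "t \<le> card (\<phi> A)"
        using card_mono[OF finite_member[OF H], of "\<phi> A \<inter> {1..t+2}"] tr by auto
      then have "(real t + u) * h ?S \<le> h (\<phi> A)" using H SH ps by (intro h_decay)
      moreover have "(real t + u) * h A \<le> (real t + u) * h ?S"
        using h_shift[OF AH rng] u_nonneg by (intro mult_left_mono) auto
      ultimately show ?thesis using H tr by auto
    qed
    have inj: "inj_on \<phi> (G x)"
    proof (rule inj_onI)
      fix A B assume "A \<in> G x" "B \<in> G x" "\<phi> A = \<phi> B"
      moreover have "X = \<phi> X - {x} \<union> {t+1, t+2}" if "X \<in> G x" for X
      proof -
        have "y \<in> X \<longleftrightarrow> y \<noteq> x" if "y \<in> {1..t+2}" for y using \<open>X \<in> G x\<close> that unfolding G_def by blast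
        from this[of "t+1"] this[of "t+2"] this[of x]
        have "x \<notin> X" "t+1 \<in> X" "t+2 \<in> X" using x by auto
        then show ?thesis using x by (auto simp: \<phi>_def)
      qed
      ultimately show "A = B" by metis
    qed
    have "(real t + u) * sum h (G x) = (\<Sum>A\<in>G x. (real t + u) * h A)"
      by (rule sum_distrib_left)
    also have "\<dots> \<le> (\<Sum>A\<in>G x. h (\<phi> A))" using img by (intro sum_mono) blast
    also have "\<dots> = sum h (\<phi> ` G x)" by (simp add: sum.reindex[OF inj])
    also have "\<dots> \<le> sum h (star \<H> {1..t} - frankl1)"
      using img by (intro sum_h_mono) (force simp: star_def frankl1_def)+
    finally show ?thesis .
  qed
  have "sum h (frankl1 - star \<H> {1..t}) = sum h (\<Union>x\<in>{1..t}. G x)"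
    by (simp only: frankl1_minus_star G_def)
  also have "\<dots> = (\<Sum>x\<in>{1..t}. sum h (G x))"
  proof (rule sum.UNION_disjoint[OF finite_atLeastAtMost])
    have "G x \<inter> G y = {}" if "x \<in> {1..t}" "x \<noteq> y" for x y
    proof -
      have "x \<in> {1..t+2}" using that by simp
      moreover have "x \<notin> A" if "A \<in> G x" for A
      proof -
        have "x \<notin> A \<inter> {1..t+2}" using that by (simp add: G_def)
        then show ?thesis using \<open>x \<in> {1..t+2}\<close> by blast
      qed
      moreover have "x \<in> A" if "A \<in> G y" for A
      proof -
        have "A \<inter> {1..t+2} = {1..t+2} - {y}" using that by (simp only: G_def mem_Collect_eq)
        then show ?thesis using \<open>x \<in> {1..t+2}\<close> \<open>x \<noteq> y\<close> by blast
      qed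
      ultimately show ?thesis by blast
    qed
    then show "\<forall>x\<in>{1..t}. \<forall>y\<in>{1..t}. x \<noteq> y \<longrightarrow> G x \<inter> G y = {}" by blast
  qed (use finG in blast)
  finally have "(real t + u) * sum h (frankl1 - star \<H> {1..t})
      = (\<Sum>x\<in>{1..t}. (real t + u) * sum h (G x))"
    by (simp add: sum_distrib_left)
  also have "\<dots> \<le> (\<Sum>x\<in>{1..t}. sum h (star \<H> {1..t} - frankl1))" by (rule sum_mono) (rule G)
  finally show ?thesis by simp
qed

lemma frankl1_le_star:
  shows "sum h frankl1 \<le> sum h (star \<H> {1..t})"
    and "u > 0 \<Longrightarrow> \<not> frankl1 \<subseteq> star \<H> {1..t} \<Longrightarrow> sum h frankl1 < sum h (star \<H> {1..t})"
proof -
  let ?S = "star \<H> {1..t}"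
  have fin: "finite frankl1" "finite ?S" using finite_\<H> by (auto simp: frankl1_def star_def)
  let ?x = "sum h (frankl1 - ?S)" and ?y = "sum h (?S - frankl1)"
  have split: "sum h frankl1 = ?x + sum h (frankl1 \<inter> ?S)" "sum h ?S = ?y + sum h (frankl1 \<inter> ?S)"
    using sum.Int_Diff[of frankl1 h ?S] sum.Int_Diff[of ?S h frankl1] fin
    by (simp_all add: Int_commute)
  have nn: "?x \<ge> 0" by (intro sum_nonneg less_imp_le h_pos) (auto simp: frankl1_def)
  have ex: "real t * ?x + u * ?x \<le> real t * ?y" using frankl1_excess by (simp add: algebra_simps)
  have "real t * ?x \<le> real t * ?y" using ex mult_nonneg_nonneg[OF u_nonneg nn] by linarith
  then have "?x \<le> ?y" using t_pos by (simp add: mult_le_cancel_left)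
  then show "sum h frankl1 \<le> sum h ?S" using split by simp
  assume "u > 0" "\<not> frankl1 \<subseteq> ?S"
  then have "?x > 0"
    using fin by (intro sum_pos h_pos) (auto simp: frankl1_def)
  then have "real t * ?x < real t * ?y" using ex mult_pos_pos[OF \<open>u > 0\<close>] by force
  then have "?x < ?y" using t_pos by (simp add: mult_less_cancel_left)
  then show "sum h frankl1 < sum h ?S" using split by simp
qed

section \<open>Heaviest families\<close>

text \<open>The second alternative records that \<open>frankl1\<close> leaves the star, since only then is its
comparison with the star strict for $u > 0$.\<close>
lemma heaviest_compressed_cases:
  assumes hv: "heaviest \<C>" and cC: "compressed n \<C>"
  shows "\<C> \<subseteq> star \<H> {1..t} \<or> (\<C> \<subseteq> frankl1 \<and> \<not> frankl1 \<subseteq> star \<H> {1..t})"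
proof (cases "\<C> \<subseteq> star \<H> {1..t}")
  case nstar: False
  have sub: "\<C> \<subseteq> \<H>" and inter: "t_intersecting t \<C>" using hv by (auto simp: heaviest_def)
  define p where "p = (LEAST p. traces_intersect \<C> p)"
  have "A \<inter> B \<inter> {1..n} = A \<inter> B" if "A \<in> \<C>" for A B using that sub ground by auto
  then have "traces_intersect \<C> n"
    using inter by (simp add: traces_intersect_def t_intersecting_def)
  then have tr: "traces_intersect \<C> p" unfolding p_def by (rule LeastI)
  have trace: "t < card (A \<inter> {1..p})" if "A \<in> \<C>" for A
    using small_trace_imp_star[OF sub cC tr that] nstar by linarith
  have big: "t < card A" if "A \<in> \<C>" for A
  proof -
    have "finite A" using that sub finite_member by blast
    then have "card (A \<inter> {1..p}) \<le> card A" by (intro card_mono) auto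
    then show ?thesis using trace[OF that] by simp
  qed
  obtain F where "F \<in> \<C>" using nstar by blast
  then have "t < p" using trace[of F] card_mono[of "{1..p}" "F \<inter> {1..p}"] by simp
  then have "\<not> traces_intersect \<C> (p - 1)"
    unfolding p_def by (intro not_less_Least) simp
  then obtain A B where AB: "A \<in> \<C>" "B \<in> \<C>" "card (A \<inter> B \<inter> {1..p-1}) < t"
    by (auto simp: traces_intersect_def not_le)
  have "{1..p} = insert p {1..p-1}" using \<open>t < p\<close> by auto
  then have ins: "A \<inter> B \<inter> {1..p} = (if p \<in> A \<inter> B then insert p (A \<inter> B \<inter> {1..p-1}) else A \<inter> B \<inter> {1..p-1})"
    by auto
  have lo: "t \<le> card (A \<inter> B \<inter> {1..p})" using traces_intersectD[OF tr] AB by blast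
  have pAB: "p \<in> A \<inter> B"
    using lo AB(3) ins by (metis not_le)
  have "card (A \<inter> B \<inter> {1..p}) \<le> Suc (card (A \<inter> B \<inter> {1..p-1}))"
    using ins pAB card_insert_le_m1 by (simp add: card_insert_if)
  then have "critical \<C> p A B" using lo AB pAB by (simp add: critical_def)
  then have "p = t + 2" using critical_level[OF hv cC tr big \<open>t < p\<close>] by blast
  then have "\<C> \<subseteq> frankl1" using trace sub by (auto simp: frankl1_def Suc_le_eq)
  then show ?thesis using nstar by blast
qed simp

lemma heaviest_compressed_le_star:
  assumes hv: "heaviest \<C>" and cC: "compressed n \<C>"
  shows "sum h \<C> \<le> sum h (star \<H> {1..t})"
    and "u > 0 \<Longrightarrow> sum h \<C> = sum h (star \<H> {1..t}) \<Longrightarrow> \<C> = star \<H> {1..t}"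
proof -
  let ?S = "star \<H> {1..t}"
  have S: "?S \<subseteq> \<H>" and F: "frankl1 \<subseteq> \<H>" by (auto simp: star_def frankl1_def)
  note cs = heaviest_compressed_cases[OF assms]
  show "sum h \<C> \<le> sum h ?S"
    using cs
  proof (elim disjE conjE)
    assume "\<C> \<subseteq> frankl1"
    then show ?thesis by (rule order_trans[OF sum_h_mono[OF _ F] frankl1_le_star(1)])
  qed (rule sum_h_mono[OF _ S])
  assume u: "u > 0" and eq: "sum h \<C> = sum h ?S"
  show "\<C> = ?S"
    using cs
  proof (elim disjE conjE)
    assume CS: "\<C> \<subseteq> ?S"
    have "\<not> \<C> \<subset> ?S" using sum_h_psubset[OF _ S, of \<C>] eq by linarith
    then show ?thesis using CS by blast
  next
    assume "\<C> \<subseteq> frankl1" "\<not> frankl1 \<subseteq> ?S"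
    then show ?thesis
      using sum_h_mono[OF _ F, of \<C>] frankl1_le_star(2)[OF u] eq by linarith
  qed
qed

lemma heaviest_compressing:
  assumes "heaviest \<C>"
  obtains \<D> where "heaviest \<D>" "compressed n \<D>" "sum h \<D> = sum h \<C>" "card ` \<D> = card ` \<C>"
proof -
  have C: "\<C> \<subseteq> \<H>" "t_intersecting t \<C>" using assms by (auto simp: heaviest_def)
  obtain \<D> where D: "\<D> \<subseteq> \<H>" "t_intersecting t \<D>" "compressed n \<D>" "sum h \<C> \<le> sum h \<D>"
      "card ` \<D> = card ` \<C>"
    using exists_compressed[OF C] by blast
  have max: "sum h \<B> \<le> sum h \<C>" if "\<B> \<subseteq> \<H>" "t_intersecting t \<B>" for \<B>
    using that assms by (simp add: heaviest_def)
  have eq: "sum h \<D> = sum h \<C>" using max[OF D(1,2)] D(4) by (rule antisym)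
  have "heaviest \<D>" using D(1,2) max by (simp add: heaviest_def eq)
  then show thesis using D(3) eq D(5) by (rule that)
qed

lemma heaviest_exists: "\<exists>\<C>. heaviest \<C>"
proof -
  let ?I = "{\<B>. \<B> \<subseteq> \<H> \<and> t_intersecting t \<B>}"
  have "finite ?I" using finite_\<H> by simp
  moreover have "{} \<in> ?I" by (simp add: t_intersecting_def)
  ultimately have "Max (sum h ` ?I) \<in> sum h ` ?I" by (intro Max_in) auto
  then obtain \<C> where "\<C> \<in> ?I" "sum h \<C> = Max (sum h ` ?I)" by auto
  moreover have "sum h \<B> \<le> Max (sum h ` ?I)" if "\<B> \<in> ?I" for \<B>
    using \<open>finite ?I\<close> that by (intro Max_ge) auto
  ultimately have "heaviest \<C>" by (simp add: heaviest_def)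
  then show ?thesis by blast
qed

lemma t_intersecting_le_star:
  assumes "\<A> \<subseteq> \<H>" "t_intersecting t \<A>"
  shows "sum h \<A> \<le> sum h (star \<H> {1..t})"
proof -
  obtain \<C> where "heaviest \<C>" using heaviest_exists by blast
  then obtain \<D> where D: "heaviest \<D>" "compressed n \<D>" by (rule heaviest_compressing)
  have "sum h \<A> \<le> sum h \<D>" using D(1) assms by (simp add: heaviest_def)
  then show ?thesis using heaviest_compressed_le_star(1)[OF D] by simp
qed

lemma t_intersecting_star:
  assumes "finite T" "card T = t"
  shows "t_intersecting t (star \<H> T)"
  unfolding t_intersecting_def star_def
proof clarsimp
  fix A B assume "A \<in> \<H>" "B \<in> \<H>" "T \<subseteq> A" "T \<subseteq> B"
  then show "t \<le> card (A \<inter> B)"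
    using card_mono[of "A \<inter> B" T] finite_member assms(2) by simp
qed

text \<open>A single $t$-subset of $F$ is a $t$-intersecting family, so the star of $[t]$ has positive
weight.\<close>
lemma initial_segment_in_\<H>:
  assumes "F \<in> \<H>" "t \<le> card F"
  shows "{1..t} \<in> \<H>"
proof -
  obtain T where T: "T \<subseteq> F" "card T = t" "finite T"
    using obtain_subset_with_card_n[OF assms(2)] by blast
  have TH: "T \<in> \<H>" using T assms subset_in_\<H> by blast
  have "sum h {T} \<le> sum h (star \<H> {1..t})"
    using TH T by (intro t_intersecting_le_star) (auto simp: t_intersecting_def)
  then have "star \<H> {1..t} \<noteq> {}" using h_pos[OF TH] by auto
  then show ?thesis using subset_in_\<H> by (auto simp: star_def)
qed

text \<open>Any $t$-element member of a $t$-intersecting family is contained in all its members, so it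
suffices to find one, and the compressed version of the family contains $[t]$.\<close>
lemma extremal_imp_star:
  assumes A: "\<A> \<subseteq> \<H>" "t_intersecting t \<A>" and u: "u > 0" and F: "F \<in> \<H>" "t \<le> card F"
    and eq: "sum h \<A> = sum h (star \<H> {1..t})"
  shows "\<exists>T. finite T \<and> card T = t \<and> \<A> = star \<H> T"
proof -
  have "heaviest \<A>" using A eq t_intersecting_le_star by (simp add: heaviest_def)
  then obtain \<D> where D: "heaviest \<D>" "compressed n \<D>" "sum h \<D> = sum h \<A>" "card ` \<D> = card ` \<A>"
    by (rule heaviest_compressing)
  have "\<D> = star \<H> {1..t}" using heaviest_compressed_le_star(2)[OF D(1,2) u] D(3) eq by simp
  then have "{1..t} \<in> \<D>" using initial_segment_in_\<H>[OF F] by (simp add: star_def)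
  then have "t \<in> card ` \<A>" using D(4) by (metis card_atLeastAtMost diff_Suc_1 image_eqI)
  then obtain T where T: "T \<in> \<A>" "card T = t" by blast
  have finT: "finite T" using T A finite_member by blast
  have "\<A> \<subseteq> star \<H> T"
  proof
    fix B assume B: "B \<in> \<A>"
    have "card T \<le> card (T \<inter> B)" using A(2) T B by (simp add: t_intersecting_def)
    then have "T \<inter> B = T" using finT by (intro card_seteq) auto
    then show "B \<in> star \<H> T" using B A by (auto simp: star_def)
  qed
  moreover have "sum h (star \<H> T) \<le> sum h \<A>"
    using t_intersecting_le_star[OF _ t_intersecting_star[OF finT T(2)]] eq by (auto simp: star_def)
  moreover have "star \<H> T \<subseteq> \<H>" by (auto simp: star_def)
  ultimately have "\<A> = star \<H> T" using sum_h_psubset[of \<A> "star \<H> T"] by fastforce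
  then show ?thesis using T(2) finT by blast
qed

end

theorem theorem2p4:
  fixes n t :: nat and u :: real
    and \<H> \<A> :: "nat set set" and h :: "nat set \<Rightarrow> real"
  assumes "1 \<le> t" and "t \<le> n"
    and "0 \<le> u" and "u > (6 - real t) / 3"
    and "\<H> \<subseteq> Pow {1..n}" and "\<H> \<noteq> {}"
    and "compressed n \<H>" and "hereditary \<H>"
    and "\<forall>A\<in>\<H>. h A > 0"
    and "\<forall>A\<in>\<H>. \<forall>B\<in>\<H>. A \<subset> B \<and> t \<le> card A \<longrightarrow> h A \<ge> (real t + u) * h B"
    and "\<forall>C\<in>\<H>. \<forall>i\<in>{1..n}. \<forall>j\<in>{1..n}. i < j \<longrightarrow> h (shift i j C) \<ge> h C"
    and "\<A> \<subseteq> \<H>" and "t_intersecting t \<A>"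
  shows "sum h \<A> \<le> sum h (star \<H> {1..t}) \<and>
    (u > 0 \<and> (\<exists>F\<in>\<H>. t \<le> card F) \<longrightarrow>
      (sum h \<A> = sum h (star \<H> {1..t}) \<longleftrightarrow>
        (\<exists>T'. finite T' \<and> card T' = t \<and> \<A> = star \<H> T' \<and>
              sum h (star \<H> T') = sum h (star \<H> {1..t}))))"
proof -
  interpret weighted_family n t u \<H> h
    using assms by unfold_locales auto
  show ?thesis
    using t_intersecting_le_star[OF assms(12,13)] extremal_imp_star[OF assms(12,13)] by metis
qed

end
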